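(* Let $x$ be a real irrational number with (infinite regular) continued fraction expansion $x=\langle q_0,q_1,q_2,\dots\rangle$, $q_0\in\mathbb{Z}$, $q_k\in\mathbb{N}$ for $k\ge1$. The sequence $(q_k)_{k\ge0}$ is eventually periodic (i.e. periodic, possibly after a finite pre-period) if and only if $x$ is a quadratic irrational number.
   Context: $\langle q_0,q_1,q_2,\dots\rangle=\lim_{j\to\infty}\langle q_0,\dots,q_j\rangle$, where $\langle q_0\rangle=q_0$ and $\langle q_0,\dots,q_j\rangle=q_0+\frac{1}{\langle q_1,\dots,q_j\rangle}$. The expansion of an irrational $x$ is given by $x_0=x$, $q_k=\lfloor x_k\rfloor$, $x_{k+1}=\frac{1}{x_k-q_k}$. A (real) quadratic irrational number is a number of the form $\frac{\sqrt{D}-b}{2a}$ with $a,b,c\in\mathbb{Z}$, where $D=b^2-4ac>0$ is not a perfect square. *)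

theory Defs
  imports Complex_Main
begin

text \<open>\<^term>\<open>cf_conv q j\<close> is the finite continued fraction $\langle q_0,\dots,q_j\rangle$.\<close>

fun cf_conv :: "(nat \<Rightarrow> int) \<Rightarrow> nat \<Rightarrow> real" where
  "cf_conv q 0 = of_int (q 0)"
| "cf_conv q (Suc j) = of_int (q 0) + 1 / cf_conv (\<lambda>k. q (Suc k)) j"

definition regular_cf_expansion :: "real \<Rightarrow> (nat \<Rightarrow> int) \<Rightarrow> bool" where
  "regular_cf_expansion x q \<longleftrightarrow> (\<forall>k\<ge>1. q k \<ge> 1) \<and> cf_conv q \<longlonglongrightarrow> x"

definition eventually_periodic :: "(nat \<Rightarrow> 'a) \<Rightarrow> bool" where
  "eventually_periodic q \<longleftrightarrow> (\<exists>N p. p > 0 \<and> (\<forall>k\<ge>N. q (k + p) = q k))"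

text \<open>The condition $a \neq 0$ is implied: for $a = 0$ the discriminant is the square $b^2$.
  Both signs of the square root are covered, since $a$ may be negative.\<close>

definition quadratic_irrational :: "real \<Rightarrow> bool" where
  "quadratic_irrational x \<longleftrightarrow>
     (\<exists>a b c D :: int. D = b\<^sup>2 - 4 * a * c \<and> D > 0 \<and> (\<nexists>n. D = n\<^sup>2) \<and>
        x = (sqrt (of_int D) - of_int b) / (2 * of_int a))"

text \<open>The expansion algorithm. Lemma \<open>regular_cf_expansion_iff\<close> below shows that for irrational
  \<open>x\<close> it yields the one and only sequence \<open>q\<close> with \<^term>\<open>regular_cf_expansion x q\<close>.\<close>

fun cf_complete_quot :: "real \<Rightarrow> nat \<Rightarrow> real" where
  "cf_complete_quot x 0 = x"
| "cf_complete_quot x (Suc k) = 1 / (cf_complete_quot x k - of_int \<lfloor>cf_complete_quot x k\<rfloor>)"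

definition cf_quot :: "real \<Rightarrow> nat \<Rightarrow> int" where
  "cf_quot x k = \<lfloor>cf_complete_quot x k\<rfloor>"

lemma irrational_step:
  assumes "x \<notin> \<rat>"
  shows "1 / (x - of_int m) \<notin> (\<rat> :: real set)"
proof
  assume "1 / (x - of_int m) \<in> \<rat>"
  then have "of_int m + 1 / (1 / (x - of_int m)) \<in> \<rat>"
    by (rule Rats_add[OF Rats_of_int Rats_divide[OF Rats_1]])
  then show False using assms by simp
qed

lemma irrational_step_gt1:
  assumes "x \<notin> \<rat>"
  shows "1 / (x - of_int \<lfloor>x\<rfloor>) > (1 :: real)"
proof -
  have "x \<noteq> of_int \<lfloor>x\<rfloor>" using assms by (metis Rats_of_int)
  then have "0 < x - of_int \<lfloor>x\<rfloor>" "x - of_int \<lfloor>x\<rfloor> < 1" by linarith+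
  then show ?thesis by simp
qed

lemma cf_complete_quot_Suc':
  "cf_complete_quot x (Suc k) = cf_complete_quot (1 / (x - of_int \<lfloor>x\<rfloor>)) k"
  by (induction k) auto

lemma cf_quot_0: "cf_quot x 0 = \<lfloor>x\<rfloor>"
  by (simp add: cf_quot_def)

lemma cf_quot_Suc: "cf_quot x (Suc k) = cf_quot (1 / (x - of_int \<lfloor>x\<rfloor>)) k"
  by (simp only: cf_quot_def cf_complete_quot_Suc')

lemma cf_complete_quot_irrational: "x \<notin> \<rat> \<Longrightarrow> cf_complete_quot x k \<notin> \<rat>"
proof (induction k)
  case (Suc k)
  then show ?case using irrational_step by simp
qed simp

lemma cf_quot_pos:
  assumes "x \<notin> \<rat>" "k \<ge> 1"
  shows "cf_quot x k \<ge> 1"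
proof -
  obtain j where j: "k = Suc j" using assms(2) by (cases k) auto
  show ?thesis
    using irrational_step_gt1[OF cf_complete_quot_irrational[OF assms(1), of j]]
    by (simp add: j cf_quot_def le_floor_iff)
qed

lemma cf_conv_ge_1: "(\<And>k. q k \<ge> 1) \<Longrightarrow> cf_conv q j \<ge> 1"
proof (induction j arbitrary: q)
  case (Suc j)
  have "cf_conv (\<lambda>k. q (Suc k)) j \<ge> 1" using Suc by auto
  moreover have "q 0 \<ge> 1" using Suc.prems by auto
  then have "real_of_int (q 0) \<ge> 1" by simp
  ultimately show ?case by (auto intro: add_increasing2)
qed auto

lemma cf_conv_error:
  assumes "x \<notin> \<rat>"
  shows "\<bar>x - cf_conv (cf_quot x) j\<bar> \<le> 2 * (1 / 2) ^ j"
  using assms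
proof (induction j arbitrary: x rule: induct_nat_012)
  case 0
  then show ?case by (simp add: cf_quot_0) linarith
next
  case 1
  define y where "y = 1 / (x - of_int \<lfloor>x\<rfloor>)"
  have "y > 1" using irrational_step_gt1[OF 1] by (simp add: y_def)
  then have m: "real_of_int \<lfloor>y\<rfloor> \<ge> 1" by simp
  have x: "x = of_int \<lfloor>x\<rfloor> + 1 / y" by (simp add: y_def)
  have c: "cf_conv (cf_quot x) (Suc 0) = of_int \<lfloor>x\<rfloor> + 1 / of_int \<lfloor>y\<rfloor>"
    by (simp add: cf_quot_0 cf_quot_Suc y_def)
  have "0 < 1 / y" "1 / y \<le> 1" "0 < 1 / real_of_int \<lfloor>y\<rfloor>" "1 / real_of_int \<lfloor>y\<rfloor> \<le> 1"
    using \<open>y > 1\<close> m by auto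
  then have "\<bar>1 / y - 1 / real_of_int \<lfloor>y\<rfloor>\<bar> \<le> 1" by linarith
  moreover have "x - cf_conv (cf_quot x) (Suc 0) = 1 / y - 1 / real_of_int \<lfloor>y\<rfloor>"
    using x c by linarith
  ultimately show ?case by simp
next
  case (ge2 j)
  define y where "y = 1 / (x - of_int \<lfloor>x\<rfloor>)"
  define z where "z = 1 / (y - of_int \<lfloor>y\<rfloor>)"
  define d where "d = cf_conv (cf_quot z) j"
  define m where "m = real_of_int \<lfloor>y\<rfloor>"
  define c where "c = m + 1 / d"
  have irr: "y \<notin> \<rat>" "z \<notin> \<rat>"
    using irrational_step ge2.prems by (auto simp: y_def z_def)
  have y1: "y > 1" using irrational_step_gt1[OF ge2.prems] by (simp add: y_def)
  have z1: "z > 1" using irrational_step_gt1[OF irr(1)] by (simp add: z_def)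
  have m1: "m \<ge> 1" using y1 by (simp add: m_def)
  have zq: "cf_quot z k \<ge> 1" for k
    using cf_quot_pos[OF irr(1), of "Suc k"] by (simp add: cf_quot_Suc z_def)
  have d1: "d \<ge> 1" unfolding d_def by (rule cf_conv_ge_1) (rule zq)
  have c1: "c > 0" using m1 d1 by (simp add: c_def add_pos_pos)
  have xy: "x = of_int \<lfloor>x\<rfloor> + 1 / y" by (simp add: y_def)
  have yz: "y = m + 1 / z" by (simp add: z_def m_def)
  have conv: "cf_conv (cf_quot x) (Suc (Suc j)) = of_int \<lfloor>x\<rfloor> + 1 / c"
    by (simp add: cf_quot_0 cf_quot_Suc y_def z_def d_def m_def c_def)
  have "y * z = m * z + 1" using yz z1 by (simp add: field_simps)
  moreover have "m * z \<ge> 1 * 1" using m1 z1 by (intro mult_mono) auto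
  ultimately have A: "y * z \<ge> 2" by simp
  have "c * d = m * d + 1" using d1 by (simp add: c_def field_simps)
  moreover have "m * d \<ge> 1 * 1" using m1 d1 by (intro mult_mono) auto
  ultimately have B: "c * d \<ge> 2" by simp
  have AB: "(y * z) * (c * d) \<ge> 2 * 2" using A B by (intro mult_mono) auto
  have "x - cf_conv (cf_quot x) (Suc (Suc j)) = 1 / y - 1 / c" using xy conv by linarith
  also have "\<dots> = (c - y) / (y * c)" using y1 c1 by (simp add: field_simps)
  also have "c - y = (z - d) / (z * d)"
    unfolding c_def using yz z1 d1 by (simp add: field_simps)
  finally have "\<bar>x - cf_conv (cf_quot x) (Suc (Suc j))\<bar> = \<bar>z - d\<bar> / \<bar>(y * z) * (c * d)\<bar>"
    by (simp add: abs_mult ac_simps)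
  also have "\<dots> = \<bar>z - d\<bar> / ((y * z) * (c * d))" using AB by simp
  also have "\<dots> \<le> \<bar>z - d\<bar> / 4" using AB by (intro divide_left_mono) auto
  also have "\<dots> \<le> (2 * (1 / 2) ^ j) / 4" using ge2.IH(1)[OF irr(2)] by (simp add: d_def)
  finally show ?case by simp
qed

lemma regular_cf_expansion_cf_quot:
  assumes "x \<notin> \<rat>"
  shows "regular_cf_expansion x (cf_quot x)"
proof -
  have "(\<lambda>j. (1 / 2 :: real) ^ j) \<longlonglongrightarrow> 0"
    by (rule LIMSEQ_realpow_zero) auto
  moreover have "\<forall>\<^sub>F j in sequentially. norm (cf_conv (cf_quot x) j - x) \<le> norm ((1 / 2 :: real) ^ j) * 2"
    using cf_conv_error[OF assms] by (intro always_eventually) (simp add: abs_minus_commute mult.commute)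
  ultimately have "(\<lambda>j. cf_conv (cf_quot x) j - x) \<longlonglongrightarrow> 0"
    by (rule tendsto_0_le)
  then have "cf_conv (cf_quot x) \<longlonglongrightarrow> x" by (rule LIM_zero_cancel)
  then show ?thesis using cf_quot_pos[OF assms] by (simp add: regular_cf_expansion_def)
qed

lemma regular_cf_expansion_step:
  assumes "x \<notin> \<rat>" "regular_cf_expansion x q"
  shows "q 0 = \<lfloor>x\<rfloor>"
    and "regular_cf_expansion (1 / (x - of_int \<lfloor>x\<rfloor>)) (\<lambda>k. q (Suc k))"
proof -
  define t where "t = (\<lambda>k. q (Suc k))"
  have pos: "t k \<ge> 1" for k using assms(2) by (auto simp: regular_cf_expansion_def t_def)
  have "cf_conv q \<longlonglongrightarrow> x" using assms(2) by (simp add: regular_cf_expansion_def)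
  then have "(\<lambda>j. cf_conv q (Suc j)) \<longlonglongrightarrow> x" by (rule LIMSEQ_Suc)
  then have "(\<lambda>j. cf_conv q (Suc j) - of_int (q 0)) \<longlonglongrightarrow> x - of_int (q 0)"
    by (intro tendsto_diff tendsto_const)
  then have "(\<lambda>j. 1 / cf_conv t j) \<longlonglongrightarrow> x - of_int (q 0)" by (simp add: t_def)
  moreover have ne: "x - of_int (q 0) \<noteq> 0"
    using assms(1) by (metis Rats_of_int eq_iff_diff_eq_0)
  ultimately have "(\<lambda>j. 1 / (1 / cf_conv t j)) \<longlonglongrightarrow> 1 / (x - of_int (q 0))"
    by (intro tendsto_divide tendsto_const)
  then have lim: "cf_conv t \<longlonglongrightarrow> 1 / (x - of_int (q 0))" by simp
  then have ge: "1 / (x - of_int (q 0)) \<ge> 1"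
    by (rule LIMSEQ_le_const) (use cf_conv_ge_1 pos in blast)
  then have gt0: "x - of_int (q 0) > 0"
    by (smt (verit) zero_less_divide_1_iff)
  with ge have "x - of_int (q 0) \<le> 1" by (simp add: field_simps)
  moreover have "x \<noteq> of_int (q 0 + 1)" using assms(1) by (metis Rats_of_int)
  ultimately show q0: "q 0 = \<lfloor>x\<rfloor>" using gt0 by (intro floor_unique[symmetric]) auto
  show "regular_cf_expansion (1 / (x - of_int \<lfloor>x\<rfloor>)) (\<lambda>k. q (Suc k))"
    using lim pos q0 by (simp add: regular_cf_expansion_def t_def)
qed

lemma regular_cf_expansion_iff:
  assumes "x \<notin> \<rat>"
  shows "regular_cf_expansion x q \<longleftrightarrow> q = cf_quot x"
proof
  assume "regular_cf_expansion x q"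
  then have "q k = cf_quot x k" for k
    using assms
  proof (induction k arbitrary: x q)
    case 0
    then show ?case using regular_cf_expansion_step(1) by (simp add: cf_quot_0)
  next
    case (Suc k)
    show ?case
      using Suc.IH[OF regular_cf_expansion_step(2)[OF Suc.prems(2,1)]
          irrational_step[OF Suc.prems(2)]]
      by (simp add: cf_quot_Suc)
  qed
  then show "q = cf_quot x" by blast
qed (use regular_cf_expansion_cf_quot[OF assms] in simp)

end

(*
  If the expansion is periodic from N on, with period p, then the complete quotients x_N and
  x_(N+p) have the same expansion and hence coincide; as x_N is a non-trivial integral Moebius
  transform of x_(N+p), it is a root of an integral quadratic polynomial, and so is x.

  Conversely, let y be the second root of the quadratic polynomial of x and expand y with the
  partial quotients of x. The resulting pairs (x_k, y_k) are the roots of integral quadratic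
  polynomials with one fixed discriminant. Some y_k is negative: otherwise the partial quotients
  of x would be the regular expansion of y as well, so that x = y. Once negative, y_k stays
  negative; the roots then have opposite signs, so a c < 0, which leaves finitely many
  polynomials of the given discriminant. Hence some x_k is repeated.
*)
theory Submission
  imports Defs
begin

section \<open>Tails and uniqueness of the expansion\<close>

lemma irrational_cf_quot_inject:
  assumes "x \<notin> \<rat>" "y \<notin> \<rat>" "cf_quot x = cf_quot y"
  shows "x = y"
  using regular_cf_expansion_cf_quot[OF assms(1)] regular_cf_expansion_cf_quot[OF assms(2)] assms(3)
  by (metis LIMSEQ_unique regular_cf_expansion_def)

lemma cf_complete_quot_add:
  "cf_complete_quot x (m + k) = cf_complete_quot (cf_complete_quot x m) k"
  by (induction k) auto

lemma cf_quot_add: "cf_quot x (m + k) = cf_quot (cf_complete_quot x m) k"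
  by (simp add: cf_quot_def cf_complete_quot_add)

lemma cf_complete_quot_diff_neq_0:
  assumes "x \<notin> \<rat>"
  shows "cf_complete_quot x k - of_int (cf_quot x k) \<noteq> 0"
  using cf_complete_quot_irrational[OF assms, of k] by (metis Rats_of_int eq_iff_diff_eq_0)

section \<open>Quadratic irrationals as irrational roots of integral quadratics\<close>

definition int_quadratic_root :: "real \<Rightarrow> bool" where
  "int_quadratic_root x \<longleftrightarrow>
     (\<exists>a b c :: int. a \<noteq> 0 \<and> of_int a * x\<^sup>2 + of_int b * x + of_int c = 0)"

text \<open>Completing the square gives \<open>(2 a x + b)^2 = D\<close> for a root, so a perfect
  square \<open>D\<close> would make \<open>x\<close> rational. Hence the irrationality of
  \<open>x\<close> supplies the conditions on \<open>D\<close>.\<close>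

lemma quadratic_irrational_iff:
  assumes "x \<notin> \<rat>"
  shows "quadratic_irrational x \<longleftrightarrow> int_quadratic_root x"
proof
  assume "quadratic_irrational x"
  then obtain a b c D :: int where D: "D = b\<^sup>2 - 4 * a * c" "D > 0" "\<nexists>n. D = n\<^sup>2"
    and x: "x = (sqrt (of_int D) - of_int b) / (2 * of_int a)"
    unfolding quadratic_irrational_def by blast
  have a: "a \<noteq> 0" using D by auto
  have "2 * of_int a * x + of_int b = sqrt (of_int D)" using a by (simp add: x)
  then have "(2 * of_int a * x + of_int b)\<^sup>2 = (of_int D :: real)" using D(2) by simp
  then have "4 * of_int a * (of_int a * x\<^sup>2 + of_int b * x + of_int c) = 0"
    using D(1) by (simp add: power2_eq_square algebra_simps)
  then have "of_int a * x\<^sup>2 + of_int b * x + of_int c = 0" using a by simp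
  with a show "int_quadratic_root x" unfolding int_quadratic_root_def by blast
next
  assume "int_quadratic_root x"
  then obtain a b c :: int
    where a: "a \<noteq> 0" and root: "of_int a * x\<^sup>2 + of_int b * x + of_int c = 0"
    unfolding int_quadratic_root_def by blast
  define D where "D = b\<^sup>2 - 4 * a * c"
  have "(2 * of_int a * x + of_int b)\<^sup>2
      = 4 * of_int a * (of_int a * x\<^sup>2 + of_int b * x + of_int c) + of_int D"
    by (simp add: D_def power2_eq_square algebra_simps)
  then have sq: "(2 * of_int a * x + of_int b)\<^sup>2 = (of_int D :: real)" using root by simp
  then have sqrt: "sqrt (of_int D) = \<bar>2 * of_int a * x + of_int b\<bar>"
    by (metis real_sqrt_abs)
  have nonsquare: "\<nexists>n. D = n\<^sup>2"
  proof
    assume "\<exists>n. D = n\<^sup>2"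
    then obtain n where "D = n\<^sup>2" by blast
    then have "(2 * of_int a * x + of_int b)\<^sup>2 = (of_int n :: real)\<^sup>2" using sq by simp
    then consider "x = (of_int n - of_int b) / (2 * of_int a)"
      | "x = (- of_int n - of_int b) / (2 * of_int a)"
      using a by (auto simp: power2_eq_iff field_simps)
    then show False using assms by cases auto
  qed
  have "(of_int D :: real) \<ge> 0" using sq by (metis zero_le_power2)
  moreover have "D \<noteq> 0" using nonsquare by (metis zero_power2)
  ultimately have D0: "D > 0" by simp
  show "quadratic_irrational x"
  proof (cases "2 * of_int a * x + of_int b \<ge> 0")
    case True
    then have "x = (sqrt (of_int D) - of_int b) / (2 * of_int a)"
      using a sqrt by (simp add: field_simps)
    then show ?thesis using D_def D0 nonsquare unfolding quadratic_irrational_def by blast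
  next
    case False
    \<comment> \<open>Here \<open>x\<close> carries the minus sign before the square root. Negating
      all three coefficients turns it into a plus sign and keeps \<open>D\<close>.\<close>
    then have "x = (sqrt (of_int D) - of_int (- b)) / (2 * of_int (- a))"
      using a sqrt by (simp add: field_simps)
    moreover have "D = (- b)\<^sup>2 - 4 * (- a) * (- c)" by (simp add: D_def)
    ultimately show ?thesis using D0 nonsquare unfolding quadratic_irrational_def by blast
  qed
qed

section \<open>Periodic expansions give quadratic irrationals\<close>

lemma int_quadratic_root_step:
  assumes "x \<notin> \<rat>" "int_quadratic_root (1 / (x - of_int m))"
  shows "int_quadratic_root x"
proof -
  obtain a b c :: int where a: "a \<noteq> 0"
    and root: "of_int a * (1 / (x - of_int m))\<^sup>2 + of_int b * (1 / (x - of_int m)) + of_int c = 0"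
    using assms(2) unfolding int_quadratic_root_def by blast
  define u where "u = x - of_int m"
  have u: "u \<noteq> 0" "u \<notin> \<rat>"
    using assms(1) Rats_add[OF Rats_of_int[of m], of u] by (auto simp: u_def)
  \<comment> \<open>Inverting the root reverses the coefficients, so \<open>c\<close> becomes the
    leading one. It cannot vanish, as \<open>u\<close> would then be rational.\<close>
  have "of_int a + of_int b * u + of_int c * u\<^sup>2
      = u\<^sup>2 * (of_int a * (1 / u)\<^sup>2 + of_int b * (1 / u) + of_int c)"
    using u by (simp add: field_simps power2_eq_square)
  then have eq: "of_int a + of_int b * u + of_int c * u\<^sup>2 = 0" using root by (simp add: u_def)
  have "c \<noteq> 0"
  proof
    assume c: "c = 0"
    then have "b \<noteq> 0" using eq a by auto
    then have "u = - of_int a / of_int b" using eq c by (simp add: field_simps)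
    then show False using u(2) by simp
  qed
  moreover have "of_int c * x\<^sup>2 + of_int (b - 2 * c * m) * x + of_int (a - b * m + c * m\<^sup>2) = 0"
    using eq by (simp add: u_def power2_eq_square algebra_simps)
  ultimately show ?thesis unfolding int_quadratic_root_def by blast
qed

lemma int_quadratic_root_if_cf_complete_quot:
  assumes "x \<notin> \<rat>" "int_quadratic_root (cf_complete_quot x k)"
  shows "int_quadratic_root x"
  using assms(2)
proof (induction k)
  case (Suc k)
  then show ?case
    using int_quadratic_root_step[OF cf_complete_quot_irrational[OF assms(1)]] by simp
qed simp

text \<open>The matrix with rows \<open>A, B\<close> and \<open>C, D\<close> is the product of the
  matrices with rows \<open>q_i, 1\<close> and \<open>1, 0\<close> for \<open>i \<le> k\<close>. The
  bound on \<open>C\<close> makes the quadratic equation nontrivial once the complete quotient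
  equals \<open>x\<close>; the bound on \<open>D\<close> carries it through the induction. The index
  is \<open>Suc k\<close> because index 0 gives the identity matrix, where
  \<open>C = 0\<close>.\<close>

lemma cf_complete_quot_moebius:
  assumes "x \<notin> \<rat>"
  shows "\<exists>A B C D :: int. C \<ge> 1 \<and> D \<ge> 0 \<and>
    x * (of_int C * cf_complete_quot x (Suc k) + of_int D)
      = of_int A * cf_complete_quot x (Suc k) + of_int B"
proof (induction k)
  case 0
  have "x - of_int \<lfloor>x\<rfloor> \<noteq> 0"
    using cf_complete_quot_diff_neq_0[OF assms, of 0] by (simp add: cf_quot_0)
  then have "x * (of_int 1 * cf_complete_quot x (Suc 0) + of_int 0)
      = of_int \<lfloor>x\<rfloor> * cf_complete_quot x (Suc 0) + of_int 1"
    by (simp add: field_simps)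
  then show ?case by (meson order_refl zero_le_one)
next
  case (Suc k)
  then obtain A B C D :: int where CD: "C \<ge> 1" "D \<ge> 0"
    and eq: "x * (of_int C * cf_complete_quot x (Suc k) + of_int D)
      = of_int A * cf_complete_quot x (Suc k) + of_int B"
    by blast
  define m y z where "m = cf_quot x (Suc k)"
    and "y = cf_complete_quot x (Suc k)" and "z = cf_complete_quot x (Suc (Suc k))"
  have ne: "y - of_int m \<noteq> 0"
    using cf_complete_quot_diff_neq_0[OF assms] by (simp only: y_def m_def not_False_eq_True)
  have zdef: "z = 1 / (y - of_int m)" by (simp add: z_def y_def m_def cf_quot_def)
  then have yz: "y * z = of_int m * z + 1" using ne by (simp add: field_simps)
  \<comment> \<open>After multiplication by \<open>z\<close>, the relation
    \<open>y z = m z + 1\<close> eliminates \<open>y\<close>.\<close>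
  have "x * (of_int C * y + of_int D) * z = (of_int A * y + of_int B) * z"
    using eq by (simp only: y_def)
  then have "x * (of_int C * (y * z) + of_int D * z) = of_int A * (y * z) + of_int B * z"
    by (simp add: algebra_simps)
  then have "x * (of_int (C * m + D) * z + of_int C) = of_int (A * m + B) * z + of_int A"
    unfolding yz by (simp add: algebra_simps)
  moreover have "m \<ge> 1" using cf_quot_pos[OF assms] by (simp add: m_def)
  then have "C * m \<ge> 1 * 1" using CD by (intro mult_mono) auto
  then have "C * m + D \<ge> 1" "C \<ge> 0" using CD by auto
  ultimately show ?case unfolding z_def by blast
qed

lemma int_quadratic_root_if_purely_periodic:
  assumes "x \<notin> \<rat>" "p > 0" "cf_complete_quot x p = x"
  shows "int_quadratic_root x"
proof -
  obtain k where "p = Suc k" using assms(2) gr0_implies_Suc by blast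
  then obtain A B C D :: int where "C \<ge> 1" and eq: "x * (of_int C * x + of_int D) = of_int A * x + of_int B"
    using cf_complete_quot_moebius[OF assms(1), of k] assms(3) by metis
  then have "of_int C * x\<^sup>2 + of_int (D - A) * x + of_int (- B) = 0" "C \<noteq> 0"
    by (auto simp: power2_eq_square algebra_simps)
  then show ?thesis unfolding int_quadratic_root_def by blast
qed

lemma quadratic_irrational_if_eventually_periodic:
  assumes "x \<notin> \<rat>" "eventually_periodic (cf_quot x)"
  shows "quadratic_irrational x"
proof -
  obtain N p where p: "p > 0" and per: "\<And>k. k \<ge> N \<Longrightarrow> cf_quot x (k + p) = cf_quot x k"
    using assms(2) unfolding eventually_periodic_def by blast
  \<comment> \<open>Periodicity says that the tails from \<open>N + p\<close> and from
    \<open>N\<close> agree, so the complete quotients with these expansions coincide.\<close>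
  have "cf_quot (cf_complete_quot x (N + p)) k = cf_quot (cf_complete_quot x N) k" for k
    using per[of "N + k"] by (simp flip: cf_quot_add add: ac_simps)
  then have "cf_complete_quot x (N + p) = cf_complete_quot x N"
    using assms(1) by (intro irrational_cf_quot_inject cf_complete_quot_irrational) auto
  then have "int_quadratic_root (cf_complete_quot x N)"
    using int_quadratic_root_if_purely_periodic[OF cf_complete_quot_irrational[OF assms(1)] p]
    by (simp add: cf_complete_quot_add)
  then show ?thesis
    using int_quadratic_root_if_cf_complete_quot quadratic_irrational_iff assms(1) by blast
qed

section \<open>The conjugate root expanded with the partial quotients of \<open>x\<close>\<close>

fun cf_remainder :: "(nat \<Rightarrow> int) \<Rightarrow> real \<Rightarrow> nat \<Rightarrow> real" where
  "cf_remainder q y 0 = y"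
| "cf_remainder q y (Suc k) = 1 / (cf_remainder q y k - of_int (q k))"

lemma cf_remainder_irrational: "y \<notin> \<rat> \<Longrightarrow> cf_remainder q y k \<notin> \<rat>"
proof (induction k)
  case (Suc k)
  then show ?case using irrational_step by simp
qed simp

text \<open>Subtracting a positive integer from a negative number and inverting leaves it negative.
  The start \<open>K \<ge> 1\<close> avoids \<open>q 0\<close>, which may be negative.\<close>

lemma cf_remainder_negative_mono:
  assumes "\<And>k. k \<ge> 1 \<Longrightarrow> q k \<ge> 1" "K \<ge> 1" "cf_remainder q y K < 0" "k \<ge> K"
  shows "cf_remainder q y k < 0"
  using assms(4)
proof (induction k rule: dec_induct)
  case base
  then show ?case using assms(3) by simp
next
  case (step n)
  have "q n \<ge> 1" using assms(1,2) step by simp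
  then have "cf_remainder q y n - of_int (q n) < 0" using step.IH by linarith
  then show ?case by simp
qed

lemma cf_remainder_eventually_negative:
  assumes "x \<notin> \<rat>" "y \<notin> \<rat>" "y \<noteq> x"
  shows "\<exists>K\<ge>1. cf_remainder (cf_quot x) y K < 0"
proof (rule ccontr)
  assume neg: "\<not> ?thesis"
  let ?r = "cf_remainder (cf_quot x) y"
  have pos: "?r (Suc k) > 0" for k
  proof -
    have "?r (Suc k) \<noteq> 0" using cf_remainder_irrational[OF assms(2)] by (metis Rats_0)
    moreover have "\<not> ?r (Suc k) < 0" using neg by (metis le_add1 plus_1_eq_Suc)
    ultimately show ?thesis by linarith
  qed
  have gt: "?r k > of_int (cf_quot x k)" for k
    using pos[of k] by simp
  have floor: "\<lfloor>?r k\<rfloor> = cf_quot x k" for k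
  proof -
    \<comment> \<open>The next remainder exceeds \<open>q_(k+1) \<ge> 1\<close>, so its reciprocal,
      the fractional excess over \<open>q_k\<close>, lies strictly between 0 and 1.\<close>
    have "real_of_int (cf_quot x (Suc k)) \<ge> 1" using cf_quot_pos[OF assms(1), of "Suc k"] by simp
    then have "1 / (?r k - of_int (cf_quot x k)) > 1" using gt[of "Suc k"] by simp
    then have "?r k < of_int (cf_quot x k) + 1" using gt[of k] by (simp add: field_simps)
    with gt[of k] show ?thesis by (intro floor_unique) auto
  qed
  have "cf_complete_quot y k = ?r k" for k
    by (induction k) (simp_all add: floor)
  then have "cf_quot y = cf_quot x" by (auto simp: cf_quot_def[of y] floor)
  then show False using irrational_cf_quot_inject assms by blast
qed

text \<open>Vieta's formulas make \<open>x\<close> and \<open>y\<close> the full pair of roots,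
  counted with multiplicity; two separate root equations would also allow the same simple root
  twice.\<close>

definition roots_of_int_quadratic :: "int \<times> int \<times> int \<Rightarrow> real \<Rightarrow> real \<Rightarrow> bool" where
  "roots_of_int_quadratic = (\<lambda>(a, b, c) x y.
     a \<noteq> 0 \<and> of_int a * (x + y) = - of_int b \<and> of_int a * (x * y) = of_int c)"

fun discriminant :: "int \<times> int \<times> int \<Rightarrow> int" where
  "discriminant (a, b, c) = b\<^sup>2 - 4 * a * c"

lemma roots_of_int_quadratic_step:
  assumes "roots_of_int_quadratic t x y" "x \<noteq> of_int m" "y \<noteq> of_int m"
  shows "\<exists>t'. discriminant t' = discriminant t \<and>
    roots_of_int_quadratic t' (1 / (x - of_int m)) (1 / (y - of_int m))"
proof -
  obtain a b c where t: "t = (a, b, c)" by (cases t)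
  have a: "a \<noteq> 0" and b: "of_int b = - of_int a * (x + y)" and c: "of_int c = of_int a * (x * y)"
    using assms(1) by (auto simp: t roots_of_int_quadratic_def)
  \<comment> \<open>Translating the variable by \<open>m\<close> gives the coefficients
    \<open>a, b', a'\<close>; inverting the roots reverses them. Both operations preserve the
    discriminant.\<close>
  define a' b' where "a' = a * m\<^sup>2 + b * m + c" and "b' = 2 * a * m + b"
  define u v where "u = x - of_int m" and "v = y - of_int m"
  have uv: "u \<noteq> 0" "v \<noteq> 0" using assms by (auto simp: u_def v_def)
  have a'_eq: "of_int a' = of_int a * (u * v)"
    by (simp add: a'_def b c u_def v_def power2_eq_square algebra_simps)
  have b'_eq: "of_int b' = - (of_int a * (u + v))"
    by (simp add: b'_def b u_def v_def algebra_simps)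
  have "a' \<noteq> 0" using a'_eq a uv by (metis mult_eq_0_iff of_int_eq_0_iff)
  moreover have "of_int a' * (1 / u + 1 / v) = - of_int b'" "of_int a' * (1 / u * (1 / v)) = of_int a"
    unfolding a'_eq b'_eq using uv by (simp_all add: field_simps)
  ultimately have "roots_of_int_quadratic (a', b', a) (1 / u) (1 / v)"
    by (simp add: roots_of_int_quadratic_def mult.commute[of v u])
  moreover have "discriminant (a', b', a) = discriminant t"
    by (simp add: t a'_def b'_def power2_eq_square algebra_simps)
  ultimately show ?thesis unfolding u_def v_def by blast
qed

lemma roots_of_int_quadratic_cf:
  assumes "x \<notin> \<rat>" "y \<notin> \<rat>" "roots_of_int_quadratic t x y"
  shows "\<exists>t'. discriminant t' = discriminant t \<and>
    roots_of_int_quadratic t' (cf_complete_quot x k) (cf_remainder (cf_quot x) y k)"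
proof (induction k)
  case 0
  then show ?case using assms(3) by (metis cf_complete_quot.simps(1) cf_remainder.simps(1))
next
  case (Suc k)
  have "cf_complete_quot x k \<noteq> of_int (cf_quot x k)"
    and "cf_remainder (cf_quot x) y k \<noteq> of_int (cf_quot x k)"
    using cf_complete_quot_irrational[OF assms(1)] cf_remainder_irrational[OF assms(2)]
    by (metis Rats_of_int)+
  then show ?case using Suc roots_of_int_quadratic_step
    by (metis cf_complete_quot.simps(2) cf_quot_def cf_remainder.simps(2))
qed

text \<open>If \<open>a c < 0\<close>, the discriminant is \<open>b^2 + 4 |a c|\<close>, a sum of
  nonnegative terms, which bounds every coefficient.\<close>

lemma finite_discriminant_mixed_signs:
  "finite {t. discriminant t = \<Delta> \<and> fst t * snd (snd t) < 0}"
proof (rule finite_subset)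
  show "{t. discriminant t = \<Delta> \<and> fst t * snd (snd t) < 0}
    \<subseteq> {-\<Delta>..\<Delta>} \<times> {-\<Delta>..\<Delta>} \<times> {-\<Delta>..\<Delta>}"
  proof
    fix t
    assume "t \<in> {t. discriminant t = \<Delta> \<and> fst t * snd (snd t) < 0}"
    moreover obtain a b c where t: "t = (a, b, c)" by (cases t)
    ultimately have D: "b\<^sup>2 + 4 * \<bar>a * c\<bar> = \<Delta>" and ac: "a * c < 0" by auto
    have "\<bar>a\<bar> \<ge> 1" "\<bar>c\<bar> \<ge> 1" using ac by (auto simp: mult_less_0_iff)
    then have "\<bar>a\<bar> * 1 \<le> \<bar>a\<bar> * \<bar>c\<bar>" "1 * \<bar>c\<bar> \<le> \<bar>a\<bar> * \<bar>c\<bar>"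
      by (intro mult_left_mono mult_right_mono; simp)+
    moreover have "\<bar>b\<bar> \<le> b\<^sup>2"
      using self_le_power[of "\<bar>b\<bar>" 2] by (cases "b = 0") auto
    moreover have "b\<^sup>2 \<ge> 0" by simp
    ultimately have "\<bar>a\<bar> \<le> \<Delta>" "\<bar>b\<bar> \<le> \<Delta>" "\<bar>c\<bar> \<le> \<Delta>"
      using D unfolding abs_mult by linarith+
    then show "t \<in> {-\<Delta>..\<Delta>} \<times> {-\<Delta>..\<Delta>} \<times> {-\<Delta>..\<Delta>}" by (auto simp: t)
  qed
qed simp

text \<open>Both pairs are the roots of one polynomial, so \<open>x\<close> is \<open>x'\<close> or
  \<open>y'\<close>, and its sign rules out \<open>y'\<close>.\<close>

lemma roots_of_int_quadratic_positive_unique: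
  assumes "roots_of_int_quadratic t x y" "roots_of_int_quadratic t x' y'" "x > 0" "y' < 0"
  shows "x = x'"
proof -
  obtain a b c where t: "t = (a, b, c)" by (cases t)
  have a: "a \<noteq> 0" and "of_int a * (x + y) = of_int a * (x' + y')"
    "of_int a * (x * y) = of_int a * (x' * y')"
    using assms(1,2) by (auto simp: t roots_of_int_quadratic_def)
  then have "x + y = x' + y'" "x * y = x' * y'" by auto
  then have "(x - x') * (x - y') = 0" by algebra
  then show ?thesis using assms(3,4) by auto
qed

section \<open>Quadratic irrationals have periodic expansions\<close>

lemma eventually_periodic_if_complete_quot_repeats:
  assumes "cf_complete_quot x k = cf_complete_quot x l" "k < l"
  shows "eventually_periodic (cf_quot x)"
proof -
  have "cf_quot x (n + (l - k)) = cf_quot x n" if "n \<ge> k" for n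
  proof -
    have "cf_quot x (l + (n - k)) = cf_quot x (k + (n - k))"
      by (simp only: cf_quot_add assms(1))
    then show ?thesis using that assms(2) by (simp add: add.commute)
  qed
  then show ?thesis unfolding eventually_periodic_def using assms(2) by (metis zero_less_diff)
qed

lemma eventually_periodic_if_quadratic_irrational:
  assumes "x \<notin> \<rat>" "quadratic_irrational x"
  shows "eventually_periodic (cf_quot x)"
proof -
  obtain a b c :: int
    where a: "a \<noteq> 0" and root: "of_int a * x\<^sup>2 + of_int b * x + of_int c = 0"
    using assms quadratic_irrational_iff unfolding int_quadratic_root_def by blast
  \<comment> \<open>The second root, read off from the sum of the roots.\<close>
  define y where "y = - of_int b / of_int a - x"
  define \<Delta> where "\<Delta> = discriminant (a, b, c)"
  have x_eq: "x = - of_int b / of_int a - y" by (simp add: y_def)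
  have y: "y \<notin> \<rat>"
  proof
    assume "y \<in> \<rat>"
    then have "- of_int b / of_int a - y \<in> \<rat>" by (intro Rats_diff Rats_divide) auto
    then show False using assms(1) x_eq by simp
  qed
  have "y \<noteq> x"
  proof
    \<comment> \<open>A double root would be the rational number \<open>-b / (2 a)\<close>.\<close>
    assume "y = x"
    then have "x = - of_int b / of_int (2 * a)" using x_eq a by (simp add: field_simps)
    then show False using assms(1) by (metis Rats_divide Rats_minus_iff Rats_of_int)
  qed
  then obtain K where K: "K \<ge> 1" "cf_remainder (cf_quot x) y K < 0"
    using cf_remainder_eventually_negative[OF assms(1) y] by blast
  have ay: "of_int a * y = - of_int b - of_int a * x" using a by (simp add: y_def field_simps)
  have "of_int a * (x * y) = x * (of_int a * y)" by simp
  also have "\<dots> = of_int c" unfolding ay using root by (simp add: power2_eq_square algebra_simps)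
  finally have "of_int a * (x * y) = of_int c" .
  then have roots: "roots_of_int_quadratic (a, b, c) x y"
    using a by (simp add: roots_of_int_quadratic_def y_def)
  obtain t where t: "\<And>k. discriminant (t k) = \<Delta>"
    "\<And>k. roots_of_int_quadratic (t k) (cf_complete_quot x k) (cf_remainder (cf_quot x) y k)"
    using roots_of_int_quadratic_cf[OF assms(1) y roots] unfolding \<Delta>_def by metis
  have neg: "cf_remainder (cf_quot x) y k < 0" if "k \<ge> K" for k
    using cf_remainder_negative_mono[OF cf_quot_pos[OF assms(1)] K that] .
  \<comment> \<open>This needs \<open>K \<ge> 1\<close>, since \<open>x\<close> itself may be
    negative.\<close>
  have pos: "cf_complete_quot x k > 0" if "k \<ge> K" for k
    using cf_quot_pos[OF assms(1), of k] that K(1) by (simp add: cf_quot_def)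
  \<comment> \<open>The product of the roots has the sign of \<open>a' c'\<close>, because
    \<open>a' c'\<close> is that product times the square of \<open>a'\<close>.\<close>
  have "t ` {K..} \<subseteq> {t. discriminant t = \<Delta> \<and> fst t * snd (snd t) < 0}"
  proof (clarsimp simp: t(1))
    fix k assume k: "K \<le> k"
    obtain a' b' c' where tk: "t k = (a', b', c')" by (cases "t k")
    define r s where "r = cf_complete_quot x k" and "s = cf_remainder (cf_quot x) y k"
    have a': "a' \<noteq> 0" and c': "of_int c' = of_int a' * (r * s)"
      using t(2)[of k] by (simp_all add: tk r_def s_def roots_of_int_quadratic_def)
    then have "real_of_int (a' * c') = (of_int a')\<^sup>2 * (r * s)"
      by (simp add: power2_eq_square c')
    moreover have "r * s < 0" using pos[OF k] neg[OF k] by (simp add: r_def s_def mult_pos_neg)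
    ultimately have "real_of_int (a' * c') < 0" using a' by (simp add: mult_pos_neg)
    then show "fst (t k) * snd (snd (t k)) < 0" by (simp add: tk flip: of_int_mult)
  qed
  then have "finite (t ` {K..})" using finite_discriminant_mixed_signs finite_subset by blast
  \<comment> \<open>By pigeonhole two indices share a polynomial, and its only positive root is the
    complete quotient at both.\<close>
  then have "\<not> inj_on t {K..}" using finite_imageD infinite_Ici by blast
  then obtain k l where kl: "k \<ge> K" "l \<ge> K" "k < l" "t k = t l"
    unfolding inj_on_def by (metis atLeast_iff linorder_neqE_nat)
  then have "cf_complete_quot x k = cf_complete_quot x l"
    using roots_of_int_quadratic_positive_unique t(2) pos neg by metis
  then show ?thesis using eventually_periodic_if_complete_quot_repeats kl(3) by blast
qed

theorem mainTheorem3: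
  fixes x :: real and q :: "nat \<Rightarrow> int"
  assumes "x \<notin> \<rat>"
    and "regular_cf_expansion x q"
  shows "eventually_periodic q \<longleftrightarrow> quadratic_irrational x"
proof -
  have "q = cf_quot x" using assms regular_cf_expansion_iff by simp
  then show ?thesis
    using quadratic_irrational_if_eventually_periodic[OF assms(1)]
      eventually_periodic_if_quadratic_irrational[OF assms(1)] by auto
qed

end
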